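(* Let $p$ be a prime number, let $k \geq 2$ be an integer with $k - 1 = \langle e_0, \ldots, e_t \rangle_p$, and let $x \geq (k-1)p$ be a real number. Then the inequality $$\nu_p(H(n,k)) < -(k-1)\big(\log_p n - \log_p(k-1) - 1\big)$$ holds for all integers $n \in [(k-1)p, x]$ whose base-$p$ representation has the form $n = \langle e_0, \ldots, e_t, d_{t+1}, \ldots, d_s \rangle_p$ (i.e., starts with the base-$p$ digits of $k-1$), with at most $3x^{0.835}$ exceptions.
   Context: For integers $n \geq k \geq 1$, $H(n,k) := \sum_{1 \leq i_1 < \cdots < i_k \leq n} \frac{1}{i_1 \cdots i_k}$. $\nu_p$ denotes the $p$-adic valuation on the rationals. For a prime $p$, $\langle a_0, \ldots, a_v \rangle_p := \sum_{i=0}^v a_i p^{v-i}$ denotes a base-$p$ representation, with $a_0, \ldots, a_v \in \{0, \ldots, p-1\}$ and $a_0 \neq 0$. *)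

theory Defs
  imports "HOL-Computational_Algebra.Computational_Algebra"
begin

definition H :: "nat \<Rightarrow> nat \<Rightarrow> rat" where
  "H n k = (\<Sum>S\<in>{S. S \<subseteq> {1..n} \<and> card S = k}. 1 / (\<Prod>i\<in>S. of_nat i))"

text \<open>p-adic valuation of a rational number (value 0 at 0, a convention irrelevant here).\<close>
definition padic_val :: "nat \<Rightarrow> rat \<Rightarrow> int" where
  "padic_val p q = (case quotient_of q of (a, b) \<Rightarrow>
      int (multiplicity (int p) a) - int (multiplicity (int p) b))"

function digits_rev :: "nat \<Rightarrow> nat \<Rightarrow> nat list" where
  "digits_rev p n = (if n = 0 \<or> p < 2 then [] else n mod p # digits_rev p (n div p))"
  by auto
termination by (relation "Wellfounded.measure snd") auto

definition base_digits :: "nat \<Rightarrow> nat \<Rightarrow> nat list" where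
  "base_digits p n = rev (digits_rev p n)"

end

theory Submission
  imports Defs
begin

text \<open>
  Put $K = k - 1$ and $F_e(n) = K!\cdot p^{eK} H(n,k)$, where $\lfloor n/p^e \rfloor = K$. Splitting
  $\{1,\dots,n\}$ into multiples and non-multiples of $p$ gives
  $p F_{e+1}(n) \equiv F_e(\lfloor n/p \rfloor) + p h(n) \pmod{p^2}$, where $h(n)$ is the sum of $1/i$
  over $i \le n$ prime to $p$. If the inequality fails at $n$ then $p$ divides $F_e(n)$, and then $p$
  divides $F_{e-1}(\lfloor n/p \rfloor)$, and so on up to the leading digits. The exceptions
  thus form a tree, and any two children of the same node have congruent values of $h$.

  If $pm + d$ and $pm + d + g$ are both such children, then $pm + d$ is a root modulo $p$ of the
  derivative of $\prod_{j=1}^g (X + j)$, so each difference $g$ occurs at most $g - 1$ times.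
  Therefore a node has at most $p^{5/6}$ children, and summing the sizes of the levels $p^{5e/6}$
  with $p^e \le x$ gives at most $3 x^{5/6}$ exceptions.
\<close>

section \<open>Rationals integral at p\<close>

text \<open>The localisation of the integers at \<open>p\<close>. The fraction need not be reduced,
  which keeps the closure proofs short. A congruence modulo \<open>p\<close> between such rationals
  is stated below as integrality of the difference divided by \<open>p\<close>.\<close>

definition p_integral :: "nat \<Rightarrow> rat \<Rightarrow> bool" where
  "p_integral p q \<longleftrightarrow> (\<exists>a b :: int. \<not> int p dvd b \<and> q = of_int a / of_int b)"

lemma p_integral_of_int:
  assumes "prime p"
  shows "p_integral p (of_int a)"
  unfolding p_integral_def
  by (rule exI[of _ a], rule exI[of _ 1]) (use assms prime_gt_1_nat in auto)

lemma p_integral_of_nat: "prime p \<Longrightarrow> p_integral p (of_nat n)"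
  using p_integral_of_int[of p "int n"] by simp

lemma p_integral_0: "prime p \<Longrightarrow> p_integral p 0"
  using p_integral_of_int[of p 0] by simp

lemma p_integral_1: "prime p \<Longrightarrow> p_integral p 1"
  using p_integral_of_int[of p 1] by simp

lemma p_integral_inverse_of_nat:
  assumes "\<not> p dvd n"
  shows "p_integral p (1 / of_nat n)"
  unfolding p_integral_def
  by (rule exI[of _ 1], rule exI[of _ "int n"]) (use assms in auto)

lemma p_integral_add:
  assumes "prime p" "p_integral p x" "p_integral p y"
  shows "p_integral p (x + y)"
proof -
  obtain a b c d where *: "\<not> int p dvd b" "x = of_int a / of_int b"
      "\<not> int p dvd d" "y = of_int c / of_int d"
    using assms(2,3) unfolding p_integral_def by blast
  have "\<not> int p dvd b * d"
    using * assms(1) by (simp add: prime_dvd_mult_iff)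
  moreover have "x + y = of_int (a * d + c * b) / of_int (b * d)"
    using * by (subst *(2), subst *(4), subst add_frac_eq) auto
  ultimately show ?thesis unfolding p_integral_def by blast
qed

lemma p_integral_mult:
  assumes "prime p" "p_integral p x" "p_integral p y"
  shows "p_integral p (x * y)"
proof -
  obtain a b c d where *: "\<not> int p dvd b" "x = of_int a / of_int b"
      "\<not> int p dvd d" "y = of_int c / of_int d"
    using assms(2,3) unfolding p_integral_def by blast
  have "\<not> int p dvd b * d"
    using * assms(1) by (simp add: prime_dvd_mult_iff)
  moreover have "x * y = of_int (a * c) / of_int (b * d)"
    by (simp add: *)
  ultimately show ?thesis unfolding p_integral_def by blast
qed

lemma p_integral_diff:
  assumes "prime p" "p_integral p x" "p_integral p y"
  shows "p_integral p (x - y)"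
  using p_integral_add[OF assms(1,2), of "of_int (- 1) * y"]
    p_integral_mult[OF assms(1) p_integral_of_int[OF assms(1), of "- 1"] assms(3)] by simp

lemma p_integral_power:
  "prime p \<Longrightarrow> p_integral p x \<Longrightarrow> p_integral p (x ^ n)"
  by (induction n) (auto intro: p_integral_1 p_integral_mult)

lemma p_integral_sum:
  "prime p \<Longrightarrow> (\<And>i. i \<in> A \<Longrightarrow> p_integral p (f i)) \<Longrightarrow> p_integral p (sum f A)"
  by (induction A rule: infinite_finite_induct) (auto intro: p_integral_0 p_integral_add)

lemma p_integral_prod:
  "prime p \<Longrightarrow> (\<And>i. i \<in> A \<Longrightarrow> p_integral p (f i)) \<Longrightarrow> p_integral p (prod f A)"
  by (induction A rule: infinite_finite_induct) (auto intro: p_integral_1 p_integral_mult)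

text \<open>The way back from integrality at \<open>p\<close> to plain divisibility of integers,
  needed before roots modulo \<open>p\<close> can be counted.\<close>

lemma p_integral_of_int_div_iff:
  assumes "prime p"
  shows "p_integral p (of_int m / of_nat p) \<longleftrightarrow> int p dvd m"
proof
  have p: "p > 0" using assms prime_gt_0_nat by blast
  assume "p_integral p (of_int m / of_nat p)"
  then obtain a b where *: "\<not> int p dvd b" "of_int m / of_nat p = (of_int a / of_int b :: rat)"
    unfolding p_integral_def by blast
  have "b \<noteq> 0" using *(1) by auto
  then have "of_int (m * b) = (of_int (int p * a) :: rat)"
    using *(2) p by (simp add: field_simps)
  then have "m * b = int p * a" by (simp only: of_int_eq_iff)
  then have "int p dvd m * b" by simp
  then show "int p dvd m"
    using *(1) assms by (simp add: prime_dvd_mult_iff)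
next
  have p: "p > 0" using assms prime_gt_0_nat by blast
  assume "int p dvd m"
  then obtain c where "m = int p * c" by blast
  then show "p_integral p (of_int m / of_nat p)"
    using p_integral_of_int[OF assms, of c] p by simp
qed

lemma p_integral_of_padic_val:
  assumes "prime p" "q \<noteq> 0" "padic_val p q > - int m"
  shows "p_integral p (of_nat p ^ m * q / of_nat p)"
proof -
  have p: "p > 0" using assms prime_gt_0_nat by blast
  have pr: "prime (int p)" using assms by simp
  obtain a b where ab: "quotient_of q = (a, b)" by fastforce
  have q: "q = of_int a / of_int b" and b: "b > 0"
    using quotient_of_div[OF ab] quotient_of_denom_pos[OF ab] by auto
  have a: "a \<noteq> 0" using q assms(2) by auto
  define u v where "u = multiplicity (int p) a" and "v = multiplicity (int p) b"
  obtain a' where a': "a = int p ^ u * a'"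
    using multiplicity_dvd[of "int p" a] unfolding u_def by blast
  obtain b' where b': "b = int p ^ v * b'" "\<not> int p dvd b'"
    using multiplicity_decompose'[of b "int p"] b pr unfolding v_def
    by (metis not_prime_unit less_irrefl)
  have "int u - int v > - int m"
    using assms(3) unfolding padic_val_def ab u_def v_def by simp
  \<comment> \<open>The strict inequality leaves one spare factor \<open>p\<close>, which pays for
    the division by \<open>p\<close> in the conclusion.\<close>
  then have "m + u \<ge> v + 1" by linarith
  then obtain c where c: "m + u = (v + 1) + c" by (metis le_Suc_ex)
  have "of_nat p ^ m * q / of_nat p = of_int (int p ^ c * a') / (of_int b' :: rat)"
  proof -
    have "of_nat p ^ m * q / of_nat p =
        (of_nat p ^ (m + u) * of_int a') / (of_nat p ^ (v + 1) * of_int b' :: rat)"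
      unfolding q a' b'(1) by (simp add: power_add ac_simps)
    also have "\<dots> = of_int (int p ^ c * a') / of_int b'"
      unfolding c using p by (simp add: power_add)
    finally show ?thesis .
  qed
  then show ?thesis using b'(2) unfolding p_integral_def by blast
qed

section \<open>Splitting off the multiples of p\<close>

text \<open>Expanding the product takes from each factor either \<open>f i\<close> times the
  variable or \<open>1\<close>; the indices of the first kind form \<open>S\<close>. So sums such as
  \<open>H\<close> become coefficients, and splitting the index set becomes multiplying
  polynomials.\<close>

lemma coeff_prod_linear:
  fixes f :: "'b \<Rightarrow> 'a :: comm_ring_1"
  assumes "finite A"
  shows "coeff (\<Prod>i\<in>A. [:1, f i:]) k = (\<Sum>S\<in>{S. S \<subseteq> A \<and> card S = k}. \<Prod>i\<in>S. f i)"
proof -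
  have mon: "(\<Prod>i\<in>S. monom (f i) 1) = monom (\<Prod>i\<in>S. f i) (card S)" if "finite S" for S
    using that by (induction S rule: finite_induct) (auto simp: mult_monom)
  have "(\<Prod>i\<in>A. [:1, f i:]) = (\<Prod>i\<in>A. monom (f i) 1 + 1)"
    by (intro prod.cong) (auto simp: monom_Suc monom_0 one_pCons)
  also have "\<dots> = (\<Sum>S\<in>Pow A. monom (\<Prod>i\<in>S. f i) (card S))"
    using assms by (subst prod_add) (auto intro!: sum.cong mon dest: finite_subset simp del: One_nat_def)
  finally have "coeff (\<Prod>i\<in>A. [:1, f i:]) k =
      (\<Sum>S\<in>Pow A. if card S = k then \<Prod>i\<in>S. f i else 0)"
    by (simp add: coeff_sum)
  also have "\<dots> = (\<Sum>S\<in>{S. S \<subseteq> A \<and> card S = k}. \<Prod>i\<in>S. f i)"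
    using assms by (intro sum.mono_neutral_cong_right) auto
  finally show ?thesis .
qed

lemma H_eq_coeff: "H n k = coeff (\<Prod>i\<in>{1..n}. [:1, 1 / of_nat i:]) k"
  unfolding H_def by (subst coeff_prod_linear) (auto simp: prod_dividef)

definition coprime_poly :: "nat \<Rightarrow> nat \<Rightarrow> rat poly" where
  "coprime_poly p n = (\<Prod>i\<in>{i\<in>{1..n}. \<not> p dvd i}. [:1, 1 / of_nat i:])"

definition coprime_harm :: "nat \<Rightarrow> nat \<Rightarrow> rat" where
  "coprime_harm p n = (\<Sum>i\<in>{i\<in>{1..n}. \<not> p dvd i}. 1 / of_nat i)"

lemma coeff_coprime_poly_0: "coeff (coprime_poly p n) 0 = 1"
  unfolding coprime_poly_def by (simp add: poly_0_coeff_0[symmetric] poly_prod)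

lemma coeff_coprime_poly_1: "coeff (coprime_poly p n) 1 = coprime_harm p n"
proof -
  have *: "{S. S \<subseteq> {i \<in> {1..n}. \<not> p dvd i} \<and> card S = 1} = (\<lambda>i. {i}) ` {i \<in> {1..n}. \<not> p dvd i}"
    by (auto simp: card_1_singleton_iff)
  have "inj_on (\<lambda>i. {i}) {i \<in> {1..n}. \<not> p dvd i}"
    by (auto simp: inj_on_def)
  then show ?thesis
    unfolding coprime_poly_def coprime_harm_def
    by (subst coeff_prod_linear, simp, subst *, subst sum.reindex) auto
qed

lemma p_integral_coeff_coprime_poly:
  assumes "prime p"
  shows "p_integral p (coeff (coprime_poly p n) j)"
  unfolding coprime_poly_def
  by (subst coeff_prod_linear)
    (auto intro!: p_integral_sum p_integral_prod p_integral_inverse_of_nat assms)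

text \<open>The generating polynomial factors over multiples and non-multiples of \<open>p\<close>.
  Writing the multiples as \<open>p * j\<close> with \<open>j\<close> up to \<open>n div p\<close>
  brings out \<open>p ^ l\<close> in the denominator of the coefficient of degree \<open>l\<close>;
  the rest is the Cauchy product.\<close>

lemma H_split:
  assumes "p > 0"
  shows "H n i = (\<Sum>l\<le>i. H (n div p) l / of_nat p ^ l * coeff (coprime_poly p n) (i - l))"
proof -
  have dj: "((*) p) ` {1..n div p} \<inter> {i\<in>{1..n}. \<not> p dvd i} = {}" by auto
  have "j \<in> ((*) p) ` {1..n div p}" if "j \<in> {1..n}" "p dvd j" for j
    using that assms by (auto simp: div_le_mono elim!: dvdE simp: less_eq_div_iff_mult_less_eq mult.commute)
  moreover have "p * j \<in> {1..n}" if "j \<in> {1..n div p}" for j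
    using that assms by (auto simp: less_eq_div_iff_mult_less_eq mult.commute)
  ultimately have un: "{1..n} = ((*) p) ` {1..n div p} \<union> {i\<in>{1..n}. \<not> p dvd i}"
    by (auto)
  have mul: "coeff (\<Prod>i\<in>((*) p) ` {1..n div p}. [:1, 1 / of_nat i:]) l =
      H (n div p) l / of_nat p ^ l" for l
  proof -
    have "(\<Prod>i\<in>((*) p) ` {1..n div p}. [:1, 1 / of_nat i :: rat:]) =
        (\<Prod>i\<in>{1..n div p}. [:1, 1 / of_nat (p * i):])"
      using assms by (subst prod.reindex) (auto simp: inj_on_def)
    then have "coeff (\<Prod>i\<in>((*) p) ` {1..n div p}. [:1, 1 / of_nat i:]) l =
        (\<Sum>S\<in>{S. S \<subseteq> {1..n div p} \<and> card S = l}. \<Prod>i\<in>S. 1 / of_nat (p * i) :: rat)"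
      by (simp only:) (rule coeff_prod_linear, simp)
    also have "\<dots> = (\<Sum>S\<in>{S. S \<subseteq> {1..n div p} \<and> card S = l}.
        1 / (\<Prod>i\<in>S. of_nat i) / of_nat p ^ l)"
      by (intro sum.cong refl) (auto simp: prod_dividef prod.distrib mult.commute)
    finally show ?thesis unfolding H_def by (simp add: sum_divide_distrib)
  qed
  have "H n i = coeff ((\<Prod>i\<in>((*) p) ` {1..n div p}. [:1, 1 / of_nat i:]) * coprime_poly p n) i"
    unfolding H_eq_coeff coprime_poly_def
    by (subst (1) un, subst prod.union_disjoint) (use dj in auto)
  then show ?thesis by (simp only: coeff_mult mul)
qed

text \<open>The factor \<open>fact K\<close> clears all denominators at the root
  \<open>n = K\<close>, and each further digit costs a factor \<open>p ^ K\<close>. The case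
  \<open>i = Suc K\<close> is the quantity F_e(n) of the outline; smaller \<open>i\<close> are
  carried along for the recursion.\<close>

definition scaled_H :: "nat \<Rightarrow> nat \<Rightarrow> nat \<Rightarrow> nat \<Rightarrow> nat \<Rightarrow> rat" where
  "scaled_H p K e n i = fact K * of_nat p ^ (e * K) * H n i"

text \<open>The factor \<open>p ^ i\<close> on the left keeps the exponent \<open>K + i - l\<close>
  a genuine natural number for every \<open>l\<close> up to \<open>i\<close>.\<close>

lemma scaled_H_split:
  assumes "p > 0"
  shows "of_nat p ^ i * scaled_H p K (Suc e) n i =
    (\<Sum>l\<le>i. of_nat p ^ (K + i - l) * scaled_H p K e (n div p) l * coeff (coprime_poly p n) (i - l))"
proof -
  have "of_nat p ^ i * scaled_H p K (Suc e) n i =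
      (\<Sum>l\<le>i. of_nat p ^ i * (fact K * of_nat p ^ (Suc e * K)) *
        (H (n div p) l / of_nat p ^ l * coeff (coprime_poly p n) (i - l)))"
    unfolding scaled_H_def H_split[OF assms, of n i] by (simp add: sum_distrib_left mult.assoc)
  also have "\<dots> = (\<Sum>l\<le>i. of_nat p ^ (K + i - l) * scaled_H p K e (n div p) l *
      coeff (coprime_poly p n) (i - l))"
  proof (intro sum.cong refl, goal_cases)
    case (1 l)
    then have "K + i = (K + i - l) + l" by simp
    then have "of_nat p ^ i * of_nat p ^ (Suc e * K) =
        (of_nat p ^ (K + i - l) * of_nat p ^ l * of_nat p ^ (e * K) :: rat)"
      by (metis (no_types) power_add add.commute mult_Suc add.assoc)
    then show ?case using assms unfolding scaled_H_def by (simp add: field_simps)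
  qed
  finally show ?thesis .
qed

lemma scaled_H_0_integral:
  assumes "prime p"
  shows "p_integral p (scaled_H p K 0 K i)"
proof -
  have "fact K * (1 / (\<Prod>j\<in>S. of_nat j)) = (\<Prod>j\<in>{1..K} - S. of_nat j :: rat)"
    if "S \<subseteq> {1..K}" for S
  proof -
    have "fact K = (\<Prod>j\<in>{1..K} - S. of_nat j :: rat) * (\<Prod>j\<in>S. of_nat j)"
      unfolding fact_prod of_nat_prod using that by (intro prod.subset_diff) auto
    moreover have "(\<Prod>j\<in>S. of_nat j :: rat) \<noteq> 0"
      using that finite_subset[OF that] by auto
    ultimately show ?thesis by simp
  qed
  then have "scaled_H p K 0 K i =
      (\<Sum>S\<in>{S. S \<subseteq> {1..K} \<and> card S = i}. \<Prod>j\<in>{1..K} - S. of_nat j)"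
    unfolding scaled_H_def H_def by (simp add: sum_distrib_left)
  then show ?thesis
    by (simp only:) (intro p_integral_sum p_integral_prod p_integral_of_nat assms)
qed

lemma scaled_H_0_top: "scaled_H p K 0 K K = 1"
proof -
  have "{S. S \<subseteq> {1..K} \<and> card S = K} = {{1..K}}"
    by (auto dest: card_subset_eq[rotated])
  then show ?thesis unfolding scaled_H_def H_def fact_prod by simp
qed

text \<open>Induction on \<open>e\<close>. For \<open>i\<close> at most \<open>K\<close> the
  recursion has only nonnegative powers \<open>p ^ (K - l)\<close>. For \<open>i = K\<close> every
  term but \<open>l = K\<close> is divisible by \<open>p\<close>, and that term has coefficient 1,
  so the residue 1 at the root persists.\<close>

lemma scaled_H_integral:
  assumes "prime p" "n div p ^ e = K"
  shows "i \<le> K \<Longrightarrow> p_integral p (scaled_H p K e n i)"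
    and "p_integral p ((scaled_H p K e n K - 1) / of_nat p)"
proof -
  have p: "p > 0" using assms(1) prime_gt_0_nat by blast
  have "(\<forall>i\<le>K. p_integral p (scaled_H p K e n i)) \<and>
      p_integral p ((scaled_H p K e n K - 1) / of_nat p)"
    using assms(2)
  proof (induction e arbitrary: n)
    case 0
    then show ?case using assms(1) by (auto simp: scaled_H_0_integral scaled_H_0_top p_integral_0)
  next
    case (Suc e)
    let ?s = "scaled_H p K e (n div p)" and ?c = "coeff (coprime_poly p n)"
    have IH: "\<forall>i\<le>K. p_integral p (?s i)" "p_integral p ((?s K - 1) / of_nat p)"
      using Suc.IH[of "n div p"] Suc.prems by (simp_all add: div_mult2_eq)
    have eq: "scaled_H p K (Suc e) n i = (\<Sum>l\<le>i. of_nat p ^ (K - l) * ?s l * ?c (i - l))"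
      if "i \<le> K" for i
    proof -
      have "of_nat p ^ i * scaled_H p K (Suc e) n i =
          of_nat p ^ i * (\<Sum>l\<le>i. of_nat p ^ (K - l) * ?s l * ?c (i - l))"
        unfolding scaled_H_split[OF p] sum_distrib_left
      proof (intro sum.cong refl, goal_cases)
        case (1 l)
        then have "K + i - l = i + (K - l)" using that by simp
        then show ?case by (simp add: power_add)
      qed
      then show ?thesis using p by simp
    qed
    have "p_integral p (scaled_H p K (Suc e) n i)" if "i \<le> K" for i
      unfolding eq[OF that] using that IH(1)
      by (intro p_integral_sum p_integral_mult p_integral_power p_integral_of_nat
          p_integral_coeff_coprime_poly assms(1)) auto
    moreover have "p_integral p ((scaled_H p K (Suc e) n K - 1) / of_nat p)"
    proof -
      have "scaled_H p K (Suc e) n K = (\<Sum>l<K. of_nat p ^ (K - l) * ?s l * ?c (K - l)) + ?s K"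
        unfolding eq[OF order_refl] lessThan_Suc_atMost[symmetric] sum.lessThan_Suc
        by (simp add: coeff_coprime_poly_0)
      also have "(\<Sum>l<K. of_nat p ^ (K - l) * ?s l * ?c (K - l)) =
          of_nat p * (\<Sum>l<K. of_nat p ^ (K - l - 1) * ?s l * ?c (K - l))"
        unfolding sum_distrib_left
      proof (intro sum.cong refl, goal_cases)
        case (1 l)
        then have "K - l = Suc (K - l - 1)" by simp
        then show ?case by (metis power_Suc mult.assoc)
      qed
      finally have "(scaled_H p K (Suc e) n K - 1) / of_nat p =
          (\<Sum>l<K. of_nat p ^ (K - l - 1) * ?s l * ?c (K - l)) + (?s K - 1) / of_nat p"
        using p by (simp add: field_simps)
      then show ?thesis using IH
        by (simp only:) (intro p_integral_add p_integral_sum p_integral_mult p_integral_power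
          p_integral_of_nat p_integral_coeff_coprime_poly assms(1); simp)
    qed
    ultimately show ?case by blast
  qed
  then show "i \<le> K \<Longrightarrow> p_integral p (scaled_H p K e n i)"
    and "p_integral p ((scaled_H p K e n K - 1) / of_nat p)" by auto
qed

text \<open>The congruence modulo \<open>p^2\<close> of the outline, divided by \<open>p^2\<close>.
  After cancelling \<open>p ^ K\<close>, the term \<open>l = Suc K\<close> has no power of
  \<open>p\<close>, the term \<open>l = K\<close> has one and carries \<open>coprime_harm\<close>,
  and all others have at least two.\<close>

lemma scaled_H_step:
  assumes "prime p" "n div p ^ Suc e = K"
  shows "p_integral p ((scaled_H p K (Suc e) n (Suc K) - scaled_H p K e (n div p) (Suc K) / of_nat p
    - coprime_harm p n) / of_nat p)"
proof -
  have p: "p > 0" using assms(1) prime_gt_0_nat by blast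
  let ?s = "scaled_H p K e (n div p)" and ?c = "coeff (coprime_poly p n)"
  let ?R = "(\<Sum>l<K. of_nat p ^ (K - Suc l) * ?s l * ?c (Suc K - l))"
  have "of_nat p ^ K * (of_nat p * scaled_H p K (Suc e) n (Suc K)) =
      of_nat p ^ K * (\<Sum>l\<le>Suc K. of_nat p ^ (Suc K - l) * ?s l * ?c (Suc K - l))"
  proof -
    have "of_nat p ^ K * (of_nat p * scaled_H p K (Suc e) n (Suc K)) =
        of_nat p ^ Suc K * scaled_H p K (Suc e) n (Suc K)" by simp
    also have "\<dots> = of_nat p ^ K * (\<Sum>l\<le>Suc K. of_nat p ^ (Suc K - l) * ?s l * ?c (Suc K - l))"
      unfolding scaled_H_split[OF p] sum_distrib_left
    proof (intro sum.cong refl, goal_cases)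
      case (1 l)
      then have "K + Suc K - l = K + (Suc K - l)" by simp
      then show ?case by (simp only: power_add mult.assoc)
    qed
    finally show ?thesis .
  qed
  then have "of_nat p * scaled_H p K (Suc e) n (Suc K) =
      (\<Sum>l\<le>Suc K. of_nat p ^ (Suc K - l) * ?s l * ?c (Suc K - l))"
    using p by simp
  also have "\<dots> = (\<Sum>l<K. of_nat p ^ (Suc K - l) * ?s l * ?c (Suc K - l)) +
      of_nat p * ?s K * coprime_harm p n + ?s (Suc K)"
    unfolding lessThan_Suc_atMost[symmetric] sum.lessThan_Suc
    using coeff_coprime_poly_1[of p n] by (simp add: coeff_coprime_poly_0)
  also have "(\<Sum>l<K. of_nat p ^ (Suc K - l) * ?s l * ?c (Suc K - l)) = of_nat p * (of_nat p * ?R)"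
    unfolding sum_distrib_left
  proof (intro sum.cong refl, goal_cases)
    case (1 l)
    then have "Suc K - l = Suc (Suc (K - Suc l))" by simp
    then show ?case by (metis power_Suc mult.assoc)
  qed
  \<comment> \<open>The last summand is the error of replacing \<open>?s K\<close> by 1; it is
    integral by the second part of \<open>scaled_H_integral\<close>.\<close>
  finally have "(scaled_H p K (Suc e) n (Suc K) - ?s (Suc K) / of_nat p - coprime_harm p n) / of_nat p =
      ?R + (?s K - 1) / of_nat p * coprime_harm p n"
    using p by (simp add: field_simps)
  moreover have "n div p div p ^ e = K" using assms(2) by (simp add: div_mult2_eq)
  note scaled_H_integral[OF assms(1) this]
  moreover have "p_integral p (coprime_harm p n)"
    unfolding coprime_harm_def
    by (intro p_integral_sum p_integral_inverse_of_nat assms(1)) auto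
  ultimately show ?thesis
    by (simp only:) (intro p_integral_add p_integral_sum p_integral_mult p_integral_power
          p_integral_of_nat p_integral_coeff_coprime_poly assms(1); simp)
qed

section \<open>The tree of exceptions\<close>

text \<open>Level \<open>e\<close> of the tree rooted at \<open>K\<close>, where the parent of
  \<open>n\<close> is \<open>n div p\<close>. It is defined by divisibility by \<open>p\<close>
  instead of failure of the inequality, since divisibility passes to parents.\<close>

definition exceptional :: "nat \<Rightarrow> nat \<Rightarrow> nat \<Rightarrow> nat set" where
  "exceptional p K e = {n. n div p ^ e = K \<and> p_integral p (scaled_H p K e n (Suc K) / of_nat p)}"

lemma p_integral_of_div:
  assumes "prime p" "p_integral p (x / of_nat p)"
  shows "p_integral p x"
  using p_integral_mult[OF assms(1) p_integral_of_nat[OF assms(1)] assms(2), of p] assms(1)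
    prime_gt_0_nat[OF assms(1)] by simp

lemma exceptional_parent:
  assumes "prime p" "n \<in> exceptional p K (Suc e)"
  shows "n div p \<in> exceptional p K e"
proof -
  let ?X = "scaled_H p K (Suc e) n (Suc K)" and ?Y = "scaled_H p K e (n div p) (Suc K) / of_nat p"
  have n: "n div p ^ Suc e = K" and X: "p_integral p (?X / of_nat p)"
    using assms(2) unfolding exceptional_def by auto
  have "p_integral p (coprime_harm p n)"
    unfolding coprime_harm_def
    by (intro p_integral_sum p_integral_inverse_of_nat assms(1)) auto
  then have "p_integral p (?X - coprime_harm p n - (?X - ?Y - coprime_harm p n))"
    using p_integral_of_div[OF assms(1) X] p_integral_of_div[OF assms(1) scaled_H_step[OF assms(1) n]]
      p_integral_diff[OF assms(1)] by blast
  moreover have "?X - coprime_harm p n - (?X - ?Y - coprime_harm p n) = ?Y" by simp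
  ultimately have "p_integral p ?Y" by (simp only:)
  then show ?thesis using n unfolding exceptional_def by (simp add: div_mult2_eq)
qed

text \<open>The parent's contribution \<open>?Y\<close> depends only on the common quotient and
  cancels when the two instances of \<open>scaled_H_step\<close> are subtracted.\<close>

lemma exceptional_siblings:
  assumes "prime p" "m \<in> exceptional p K (Suc e)" "n \<in> exceptional p K (Suc e)" "m div p = n div p"
  shows "p_integral p ((coprime_harm p n - coprime_harm p m) / of_nat p)"
proof -
  let ?X = "\<lambda>n. scaled_H p K (Suc e) n (Suc K)" and ?Y = "scaled_H p K e (n div p) (Suc K) / of_nat p"
  have m: "m div p ^ Suc e = K" and n: "n div p ^ Suc e = K"
    and X: "p_integral p (?X m / of_nat p)" "p_integral p (?X n / of_nat p)"
    using assms(2,3) unfolding exceptional_def by auto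
  note 1 = scaled_H_step[OF assms(1) m, unfolded assms(4)] and 2 = scaled_H_step[OF assms(1) n]
  have "(coprime_harm p n - coprime_harm p m) / of_nat p =
    (?X n / of_nat p - ?X m / of_nat p) +
    ((?X m - ?Y - coprime_harm p m) / of_nat p - (?X n - ?Y - coprime_harm p n) / of_nat p)"
    by (simp add: diff_divide_distrib)
  then show ?thesis
    using 1 2 X by (simp only:) (intro p_integral_diff p_integral_add assms(1))
qed

section \<open>Children of a node\<close>

text \<open>Lagrange's bound for roots modulo a prime, phrased with pairwise incongruent integers. A
  root \<open>a\<close> is split off by synthetic division, and primality makes the remaining
  elements roots of the quotient.\<close>

lemma card_roots_mod_prime_le:
  fixes f :: "int poly"
  assumes "prime p" "finite A" "\<not> p dvd lead_coeff f"
    and "\<And>x. x \<in> A \<Longrightarrow> p dvd poly f x"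
    and "\<And>x y. x \<in> A \<Longrightarrow> y \<in> A \<Longrightarrow> p dvd x - y \<Longrightarrow> x = y"
  shows "card A \<le> degree f"
  using assms(2-)
proof (induction "degree f" arbitrary: f A)
  case 0
  then obtain c where "f = [:c:]" using degree_eq_zeroE by metis
  with 0 have "A = {}" by force
  then show ?case by simp
next
  case (Suc n)
  show ?case
  proof (cases "A = {}")
    case False
    then obtain a where a: "a \<in> A" by blast
    define q where "q = synthetic_div f a"
    have f: "f = [:- a, 1:] * q + [:poly f a:]"
      unfolding q_def by (rule synthetic_div_correct'[symmetric])
    have dq: "degree q = n" using Suc.hyps(2) unfolding q_def by (simp add: degree_synthetic_div)
    \<comment> \<open>The divisor is monic, so the quotient keeps the leading coefficient.\<close>
    have "coeff f (Suc n) = coeff ([:- a, 1:] * q + [:poly f a:]) (Suc n)" using f by simp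
    then have "lead_coeff f = lead_coeff q"
      unfolding Suc.hyps(2)[symmetric] dq using coeff_eq_0[of q "Suc n"] dq by simp
    then have lq: "\<not> p dvd lead_coeff q" using Suc.prems by simp
    have "p dvd poly q x" if x: "x \<in> A - {a}" for x
    proof -
      have "poly f x = (x - a) * poly q x + poly f a"
        by (subst (1) f) (simp add: algebra_simps)
      then have "p dvd (x - a) * poly q x"
        using Suc.prems(3)[of x] Suc.prems(3)[of a] x a by (simp add: dvd_add_left_iff)
      moreover have "\<not> p dvd x - a" using Suc.prems(4)[of x a] x a by auto
      ultimately show ?thesis using assms(1) by (simp add: prime_dvd_mult_iff)
    qed
    then have "card (A - {a}) \<le> n"
      using Suc.hyps(1)[of q "A - {a}"] dq lq Suc.prems(1,4) by auto
    then show ?thesis using Suc.hyps(2) a Suc.prems(1) by (simp add: card_Diff_singleton)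
  qed simp
qed

text \<open>The logarithmic derivative of the product of the \<open>X + j\<close>, evaluated at
  \<open>y\<close> and cleared of denominators.\<close>

lemma sum_inverse_shift_eq_pderiv:
  assumes "\<And>j. j \<in> {1..g} \<Longrightarrow> y + int j \<noteq> 0"
  shows "(\<Prod>j\<in>{1..g}. of_int (y + int j)) * (\<Sum>j\<in>{1..g}. 1 / of_int (y + int j)) =
    (of_int (poly (pderiv (\<Prod>j\<in>{1..g}. [:int j, 1:])) y) :: rat)"
proof -
  have "(\<Prod>i\<in>{1..g}. of_int (y + int i)) * (1 / of_int (y + int j)) =
      (\<Prod>i\<in>{1..g} - {j}. of_int (y + int i) :: rat)" if "j \<in> {1..g}" for j
  proof -
    have "(of_int (y + int j) :: rat) \<noteq> 0" using assms[OF that] by (simp only: of_int_eq_0_iff) simp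
    then show ?thesis using that by (subst prod.remove[of _ j]) auto
  qed
  then show ?thesis
    by (simp add: pderiv_prod pderiv_pCons poly_sum poly_prod sum_distrib_left add.commute)
qed

lemma degree_lead_coeff_shift_prod:
  "degree (\<Prod>j\<in>{1..g}. [:int j, 1:]) = g" "lead_coeff (\<Prod>j\<in>{1..g}. [:int j, 1:]) = 1"
proof -
  show "degree (\<Prod>j\<in>{1..g}. [:int j, 1:]) = g" by (simp add: degree_prod_sum_eq)
  show "lead_coeff (\<Prod>j\<in>{1..g}. [:int j, 1:]) = 1" unfolding lead_coeff_prod by simp
qed

lemma coprime_harm_add:
  assumes "\<And>j. j \<in> {1..g} \<Longrightarrow> \<not> p dvd a + j"
  shows "coprime_harm p (a + g) - coprime_harm p a = (\<Sum>j\<in>{1..g}. 1 / of_nat (a + j))"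
proof -
  have union: "{i \<in> {1..a + g}. \<not> p dvd i} = {i \<in> {1..a}. \<not> p dvd i} \<union> (+) a ` {1..g}"
  proof (intro equalityI subsetI)
    fix i assume i: "i \<in> {i \<in> {1..a + g}. \<not> p dvd i}"
    show "i \<in> {i \<in> {1..a}. \<not> p dvd i} \<union> (+) a ` {1..g}"
    proof (cases "i \<le> a")
      case False
      then have "i = a + (i - a)" "i - a \<in> {1..g}" using i by auto
      then show ?thesis by blast
    qed (use i in auto)
  next
    fix i assume "i \<in> {i \<in> {1..a}. \<not> p dvd i} \<union> (+) a ` {1..g}"
    then consider "i \<in> {1..a}" "\<not> p dvd i" | j where "i = a + j" "j \<in> {1..g}" by blast
    then show "i \<in> {i \<in> {1..a + g}. \<not> p dvd i}"
      by cases (simp_all add: assms del: One_nat_def)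
  qed
  have disj: "{i \<in> {1..a}. \<not> p dvd i} \<inter> (+) a ` {1..g} = {}" by auto
  have "coprime_harm p (a + g) = coprime_harm p a + (\<Sum>i\<in>(+) a ` {1..g}. 1 / of_nat i)"
    unfolding coprime_harm_def union by (rule sum.union_disjoint[OF _ _ disj]) simp_all
  also have "(\<Sum>i\<in>(+) a ` {1..g}. 1 / of_nat i :: rat) = (\<Sum>j\<in>{1..g}. 1 / of_nat (a + j))"
    by (subst sum.reindex) auto
  finally show ?thesis by simp
qed

text \<open>Siblings at distance \<open>g\<close> make the sum of \<open>1 / (p * m + d + j)\<close>
  over \<open>j\<close> from 1 to \<open>g\<close> vanish modulo \<open>p\<close>, so
  \<open>p * m + d\<close> is a root of \<open>?f\<close>. Its degree is \<open>g - 1\<close> and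
  its leading coefficient \<open>g\<close> is not divisible by \<open>p\<close> when
  \<open>g < p\<close>.\<close>

lemma card_exceptional_gap_le:
  fixes p K e m g :: nat
  defines "D \<equiv> {d. d < p \<and> p * m + d \<in> exceptional p K (Suc e)}"
  assumes "prime p" "g > 0"
  shows "card {d \<in> D. d + g \<in> D} \<le> g - 1"
proof (cases "g < p")
  case True
  have p: "p > 0" using assms(2) prime_gt_0_nat by blast
  let ?f = "pderiv (\<Prod>j\<in>{1..g}. [:int j, 1:])"
  let ?y = "\<lambda>d. int (p * m + d)"
  have deg: "degree ?f = g - 1"
    by (simp only: degree_pderiv degree_lead_coeff_shift_prod)
  have "lead_coeff ?f = int g"
    unfolding deg using assms(3) degree_lead_coeff_shift_prod[of g] by (simp add: coeff_pderiv)
  then have lead: "\<not> int p dvd lead_coeff ?f"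
    using True assms(3) by (simp add: nat_dvd_not_less)
  have "int p dvd poly ?f (?y d)" if d: "d \<in> D" "d + g \<in> D" for d
  proof -
    \<comment> \<open>Both digits \<open>d\<close> and \<open>d + g\<close> are below
      \<open>p\<close>, so no multiple of \<open>p\<close> lies strictly above
      \<open>p * m + d\<close> and up to \<open>p * m + d + g\<close>.\<close>
    have nd: "\<not> p dvd p * m + d + j" if "j \<in> {1..g}" for j
    proof -
      have "0 < d + j" "d + j < p" using that d unfolding D_def by auto
      then show ?thesis by (simp add: add.assoc dvd_add_right_iff nat_dvd_not_less)
    qed
    have "d < p" "d + g < p" using d unfolding D_def by auto
    then have "(p * m + d) div p = (p * m + (d + g)) div p" using p by simp
    then have "p_integral p ((coprime_harm p (p * m + (d + g)) - coprime_harm p (p * m + d)) / of_nat p)"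
      using exceptional_siblings[OF assms(2)] d unfolding D_def by blast
    then have "p_integral p ((\<Sum>j\<in>{1..g}. 1 / of_nat (p * m + d + j)) / of_nat p)"
      using coprime_harm_add[of g p "p * m + d"] nd by (simp add: add.assoc)
    then have "p_integral p ((\<Prod>j\<in>{1..g}. of_int (?y d + int j)) *
        ((\<Sum>j\<in>{1..g}. 1 / of_nat (p * m + d + j)) / of_nat p))"
      by (intro p_integral_mult p_integral_prod p_integral_of_int assms(2))
    also have "(\<Prod>j\<in>{1..g}. of_int (?y d + int j)) *
        ((\<Sum>j\<in>{1..g}. 1 / of_nat (p * m + d + j)) / of_nat p) =
        (\<Prod>j\<in>{1..g}. of_int (?y d + int j)) * (\<Sum>j\<in>{1..g}. 1 / of_int (?y d + int j)) / (of_nat p :: rat)"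
      by simp
    also have "\<dots> = of_int (poly ?f (?y d)) / of_nat p"
      using nd by (subst sum_inverse_shift_eq_pderiv) (auto simp flip: of_nat_add of_nat_mult)
    finally show ?thesis using p_integral_of_int_div_iff[OF assms(2)] by blast
  qed
  moreover have "x = y" if xy: "x \<in> ?y ` {d \<in> D. d + g \<in> D}" "y \<in> ?y ` {d \<in> D. d + g \<in> D}"
    "int p dvd x - y" for x y
  proof -
    obtain c d where cd: "x = ?y c" "y = ?y d" "c < p" "d < p"
      using xy(1,2) unfolding D_def by auto
    then have "int p dvd int c - int d" using xy(3) by simp
    then have "int c mod int p = int d mod int p" by (simp add: mod_eq_dvd_iff)
    then show ?thesis using cd by simp
  qed
  ultimately have "card (?y ` {d \<in> D. d + g \<in> D}) \<le> degree ?f"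
    using lead assms(2) by (intro card_roots_mod_prime_le[of "int p"]) (auto simp: D_def)
  also have "card (?y ` {d \<in> D. d + g \<in> D}) = card {d \<in> D. d + g \<in> D}"
    by (rule card_image) (auto simp: inj_on_def)
  finally show ?thesis unfolding deg .
next
  \<comment> \<open>Two digits below \<open>p\<close> cannot differ by \<open>p\<close> or
    more.\<close>
  case False
  then have "{d \<in> D. d + g \<in> D} = {}" unfolding D_def by auto
  then show ?thesis by (simp only: card.empty)
qed

text \<open>Each gap between consecutive elements that is shorter than $M$ is padded to length $M$ by the sum.\<close>

lemma card_le_spread_plus_short_gaps:
  fixes S :: "nat set"
  assumes "finite S" "S \<noteq> {}"
  shows "M * card S + Min S \<le> M + Max S + (\<Sum>g\<in>{1..<M}. (M - g) * card {d \<in> S. d + g \<in> S})"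
  using assms
proof (induction S rule: finite_linorder_max_induct)
  case (insert b A)
  show ?case
  proof (cases "A = {}")
    case False
    define a where "a = Max A"
    have a: "a \<in> A" "a < b" using insert.hyps False unfolding a_def by auto
    have Max: "Max (insert b A) = b"
      using insert.hyps by (intro Max_eqI) (auto intro: less_imp_le)
    have Min: "Min (insert b A) = Min A"
      using insert.hyps False a by (simp add: min_def) (meson Min_le le_trans less_imp_le not_le)
    have card: "card (insert b A) = Suc (card A)"
      using insert.hyps by auto
    let ?c = "\<lambda>S g. card {d \<in> S. d + g \<in> S}"
    \<comment> \<open>The new maximum \<open>b\<close> creates at least the pair
      \<open>(a, b)\<close>, of weight \<open>M - (b - a)\<close>; truncated subtraction makes this
      0 for a gap of length at least \<open>M\<close>.\<close>
    have "(\<Sum>g\<in>{1..<M}. (M - g) * ?c A g + (if g = b - a then M - (b - a) else 0))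
        \<le> (\<Sum>g\<in>{1..<M}. (M - g) * ?c (insert b A) g)"
    proof (intro sum_mono)
      fix g
      show "(M - g) * ?c A g + (if g = b - a then M - (b - a) else 0) \<le> (M - g) * ?c (insert b A) g"
      proof (cases "g = b - a")
        case True
        have "Suc (?c A g) = card (insert a {d \<in> A. d + g \<in> A})"
          using insert.hyps a True by (subst card_insert_disjoint) auto
        also have "\<dots> \<le> ?c (insert b A) g"
          using insert.hyps a True by (intro card_mono) auto
        finally have "(M - g) * Suc (?c A g) \<le> (M - g) * ?c (insert b A) g"
          by (rule mult_le_mono2)
        then show ?thesis using True by simp
      next
        case False
        have "?c A g \<le> ?c (insert b A) g"
          using insert.hyps by (intro card_mono) auto
        then show ?thesis using False by simp
      qed
    qed
    moreover have "(\<Sum>g\<in>{1..<M}. if g = b - a then M - (b - a) else 0) = M - (b - a)"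
      using a by auto
    ultimately have "(\<Sum>g\<in>{1..<M}. (M - g) * ?c A g) + (M - (b - a))
        \<le> (\<Sum>g\<in>{1..<M}. (M - g) * ?c (insert b A) g)"
      by (simp add: sum.distrib)
    moreover have "M * card A + Min A \<le> M + a + (\<Sum>g\<in>{1..<M}. (M - g) * ?c A g)"
      using insert.IH False unfolding a_def by simp
    ultimately show ?thesis unfolding Max Min card using a(2) by simp
  qed simp
qed simp

section \<open>Numerical optimisation of the gap bound\<close>

lemma sum_gap_weights:
  "(\<Sum>g\<in>{1..<M}. real ((M - g) * (g - 1))) = real M * (real M - 1) * (real M - 2) / 6"
proof -
  have "(\<Sum>g\<in>{1..<M}. real ((M - g) * (g - 1))) = (\<Sum>g\<in>{1..<M}. (real M - real g) * (real g - 1))"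
    by (intro sum.cong) (auto simp: of_nat_diff)
  \<comment> \<open>Replacing \<open>M\<close> in the weights by a free constant \<open>c\<close>
    separates it from the summation limit, so induction on the limit goes through.\<close>
  also have "(\<Sum>g\<in>{1..<M}. (c - real g) * (real g - 1)) =
      (real M - 1) * (real M - 2) * (3 * c - 2 * real M) / 6" if "M \<ge> 1" for c
    using that by (induction M rule: dec_induct) (auto simp: field_simps)
  finally show ?thesis by (cases "M = 0") (auto simp: algebra_simps)
qed

text \<open>Here \<open>N\<close> stands for the number of children of a node, and the assumption is
  what the gap count yields for each cut-off \<open>M\<close>. Small \<open>p\<close> use
  \<open>M = 2\<close>; the others use a cut-off that grows with \<open>p\<close>.\<close>

lemma le_powr_five_sixths:
  fixes p :: nat and N :: real
  assumes "p \<ge> 2"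
    and N: "\<And>M::nat. M \<ge> 1 \<Longrightarrow> real M * (N - 1) \<le> real p - 1 + real M * (real M - 1) * (real M - 2) / 6"
  shows "N \<le> p powr (5/6)"
proof -
  define b where "b = real p powr (1/6)"
  have b0: "b > 0" using assms(1) unfolding b_def by simp
  have b6: "b ^ 6 = p" and b5: "b ^ 5 = p powr (5/6)"
    using assms(1) unfolding b_def by (simp_all add: powr_power)
  show ?thesis
  proof (cases "p < 8")
    case True
    \<comment> \<open>For \<open>M = 2\<close> the cubic term vanishes; the six values of
      \<open>p\<close> are then checked numerically.\<close>
    have "N \<le> (real p + 1) / 2" using N[of 2] assms(1) by (simp add: of_nat_diff)
    also have "((real p + 1) / 2) ^ 6 \<le> (b ^ 5) ^ 6"
    proof -
      have "p \<in> {2, 3, 4, 5, 6, 7}" using True assms(1) by auto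
      then have "((real p + 1) / 2) ^ 6 \<le> real p ^ 5" by (auto simp: power_divide)
      also have "\<dots> = (b ^ 5) ^ 6" unfolding b6[symmetric] by (simp flip: power_mult)
      finally show ?thesis .
    qed
    then have "(real p + 1) / 2 \<le> b ^ 5"
      using b0 power_mono_iff[of "(real p + 1) / 2" "b ^ 5" 6] by simp
    finally show ?thesis unfolding b5 .
  next
    case False
    have "2 ^ 3 \<le> (b\<^sup>2) ^ 3" using False b6 by (simp flip: power_mult)
    then have b2: "b\<^sup>2 \<ge> 2" using power_mono_iff[of 2 "b\<^sup>2" 3] by simp
    have b141: "b \<ge> 1.41"
    proof (rule ccontr)
      assume "\<not> b \<ge> 1.41"
      then have "b\<^sup>2 \<le> 1.41\<^sup>2" using b0 by (intro power_mono) auto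
      then show False using b2 by (simp add: power2_eq_square)
    qed
    \<comment> \<open>$M \approx p^{1/3}$ balances the terms $p/M$ and $M^2/6$ of the bound for $N$.\<close>
    define M where "M = nat \<lceil>b\<^sup>2\<rceil>"
    have M: "b\<^sup>2 \<le> M" "M < b\<^sup>2 + 1" "M \<ge> 2"
      using b2 unfolding M_def by linarith+
    have "real M * (N - 1) \<le> real p - 1 + real M * (real M - 1) * (real M - 2) / 6"
      using N[of M] M(3) assms(1) by (simp add: of_nat_diff)
    also have "\<dots> \<le> b ^ 6 + real M * ((real M - 1) * (real M - 2) / 6)"
      unfolding b6 by simp
    also have "b ^ 6 \<le> M * b ^ 4"
      using mult_right_mono[OF M(1), of "b ^ 4"] b0 by (simp flip: power_add)
    also have "(real M - 1) * (real M - 2) \<le> b\<^sup>2 * (b\<^sup>2 - 1)"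
      using M by (intro mult_mono) auto
    finally have "M * (N - 1) \<le> M * (b ^ 4 + b\<^sup>2 * (b\<^sup>2 - 1) / 6)"
      using M(3) by (simp add: distrib_left mult_left_mono)
    then have "N \<le> 1 + b ^ 4 + b\<^sup>2 * (b\<^sup>2 - 1) / 6"
      using M(3) by simp
    also have "\<dots> \<le> b ^ 5"
    proof -
      \<comment> \<open>The claim amounts to \<open>1 - b^2/6 \<le> b^4 * (b - 7/6)\<close>. The
        left side is at most 2/3, and the right side at least 0.96, as
        \<open>1.41 - 7/6 > 6/25\<close>.\<close>
      have "(4::real) \<le> b ^ 4" using power_mono[OF b2, of 2] by (simp flip: power_mult)
      then have "4 * (6/25) \<le> b ^ 4 * (b - 7/6)" using b141 by (intro mult_mono) auto
      moreover have "b ^ 4 * (b - 7/6) = b ^ 5 - 7/6 * b ^ 4" "b\<^sup>2 * (b\<^sup>2 - 1) = b ^ 4 - b\<^sup>2"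
        by (simp_all add: algebra_simps eval_nat_numeral)
      ultimately show ?thesis using b2 by linarith
    qed
    finally show ?thesis unfolding b5 .
  qed
qed

section \<open>Counting the exceptions\<close>

lemma card_exceptional_children_le:
  fixes p K e m :: nat
  assumes "prime p"
  shows "card {d. d < p \<and> p * m + d \<in> exceptional p K (Suc e)} \<le> real p powr (5/6)"
proof (rule le_powr_five_sixths)
  show p: "p \<ge> 2" using assms prime_ge_2_nat by blast
  fix M :: nat assume "M \<ge> 1"
  define D where "D = {d. d < p \<and> p * m + d \<in> exceptional p K (Suc e)}"
  show "real M * (real (card {d. d < p \<and> p * m + d \<in> exceptional p K (Suc e)}) - 1)
      \<le> real p - 1 + real M * (real M - 1) * (real M - 2) / 6"
    unfolding D_def[symmetric] sum_gap_weights[symmetric]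
  proof (cases "D = {}")
    case False
    have fin: "finite D" unfolding D_def by simp
    have "M * card D \<le> M + Max D + (\<Sum>g\<in>{1..<M}. (M - g) * card {d \<in> D. d + g \<in> D})"
      using card_le_spread_plus_short_gaps[OF fin False, of M] by linarith
    also have "\<dots> \<le> M + (p - 1) + (\<Sum>g\<in>{1..<M}. (M - g) * (g - 1))"
      using Max_in[OF fin False] card_exceptional_gap_le[OF assms] unfolding D_def
      by (intro add_mono sum_mono mult_le_mono2 order_refl) auto
    finally have "real (M * card D) \<le> real (M + (p - 1) + (\<Sum>g\<in>{1..<M}. (M - g) * (g - 1)))"
      by (simp only: of_nat_le_iff)
    then show "real M * (real (card D) - 1) \<le> real p - 1 + (\<Sum>g\<in>{1..<M}. real ((M - g) * (g - 1)))"
      using p by (simp add: of_nat_diff algebra_simps)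
  next
    case True
    have "0 \<le> real p - 1" "0 \<le> (\<Sum>g\<in>{1..<M}. real ((M - g) * (g - 1)))"
      using p by (auto intro: sum_nonneg)
    then show "real M * (real (card D) - 1) \<le> real p - 1 + (\<Sum>g\<in>{1..<M}. real ((M - g) * (g - 1)))"
      using True by simp
  qed
qed

text \<open>By \<open>exceptional_parent\<close>, level \<open>Suc e\<close> is covered by the
  children of level \<open>e\<close>, so each level grows by a factor of at most
  \<open>p powr (5/6)\<close>; level 0 contains at most \<open>K\<close>.\<close>

lemma card_exceptional_le:
  assumes "prime p"
  shows "finite (exceptional p K e) \<and> card (exceptional p K e) \<le> (real p powr (5/6)) ^ e"
proof (induction e)
  case 0
  have "exceptional p K 0 \<subseteq> {K}" unfolding exceptional_def by auto
  then have "card (exceptional p K 0) \<le> card {K}" and "finite (exceptional p K 0)"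
    by (auto intro: card_mono finite_subset simp del: card.insert)
  then show ?case by simp
next
  case (Suc e)
  have p: "p > 0" using assms prime_gt_0_nat by blast
  define B where "B m = (\<lambda>d. p * m + d) ` {d. d < p \<and> p * m + d \<in> exceptional p K (Suc e)}" for m
  have fin: "finite (exceptional p K e)" using Suc by simp
  have "n \<in> B (n div p)" if "n \<in> exceptional p K (Suc e)" for n
    unfolding B_def by (rule image_eqI[of _ _ "n mod p"]) (use that p in auto)
  then have sub: "exceptional p K (Suc e) \<subseteq> (\<Union>m\<in>exceptional p K e. B m)"
    using exceptional_parent[OF assms] by blast
  have finB: "finite (B m)" for m unfolding B_def by simp
  have B: "card (B m) \<le> real p powr (5/6)" for m
  proof -
    have "card (B m) \<le> card {d. d < p \<and> p * m + d \<in> exceptional p K (Suc e)}"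
      unfolding B_def by (rule card_image_le) simp
    then show ?thesis using card_exceptional_children_le[OF assms, of m K e] by linarith
  qed
  have "card (exceptional p K (Suc e)) \<le> card (\<Union>m\<in>exceptional p K e. B m)"
    using sub fin finB by (intro card_mono) auto
  also have "\<dots> \<le> (\<Sum>m\<in>exceptional p K e. card (B m))"
    using fin by (rule card_UN_le)
  finally have "real (card (exceptional p K (Suc e))) \<le> (\<Sum>m\<in>exceptional p K e. real (card (B m)))"
    by (simp only: of_nat_le_iff flip: of_nat_sum)
  also have "\<dots> \<le> real (card (exceptional p K e)) * real p powr (5/6)"
    using B by (intro sum_bounded_above) auto
  also have "\<dots> \<le> (real p powr (5/6)) ^ Suc e"
    unfolding power_Suc2 using Suc by (intro mult_right_mono) auto
  finally show ?case using sub fin finB finite_subset by blast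
qed

section \<open>Base-p digits\<close>

declare digits_rev.simps [simp del]

lemma digits_rev_0 [simp]: "digits_rev p 0 = []"
  by (subst digits_rev.simps) simp

lemma digits_rev_div: "p \<ge> 2 \<Longrightarrow> digits_rev p (n div p) = tl (digits_rev p n)"
  by (cases "n = 0", simp, subst (2) digits_rev.simps, simp)

text \<open>The list starts with the least significant digit, so dropping \<open>e\<close> entries
  is division by \<open>p ^ e\<close>.\<close>

lemma drop_digits_rev: "p \<ge> 2 \<Longrightarrow> drop e (digits_rev p n) = digits_rev p (n div p ^ e)"
  by (induction e arbitrary: n) (simp_all add: drop_Suc div_mult2_eq flip: digits_rev_div)

lemma digits_rev_inject:
  assumes "p \<ge> 2"
  shows "digits_rev p m = digits_rev p n \<Longrightarrow> m = n"
proof (induction m arbitrary: n rule: less_induct)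
  case (less m)
  have eq: "digits_rev p n = (if n = 0 then [] else n mod p # digits_rev p (n div p))" for n
    by (subst digits_rev.simps) (use assms in auto)
  show ?case
  proof (cases "m = 0 \<or> n = 0")
    case True
    then show ?thesis using less.prems eq[of m] eq[of n] by (auto split: if_splits)
  next
    case False
    then have "m mod p = n mod p" "digits_rev p (m div p) = digits_rev p (n div p)"
      using less.prems eq[of m] eq[of n] by auto
    moreover have "m div p < m" using False assms by auto
    ultimately show ?thesis using less.IH[of "m div p" "n div p"] by (metis div_mult_mod_eq)
  qed
qed

text \<open>A prefix of the usual digit list is what remains after dropping low digits. With
  \<open>e\<close> the difference of the two lengths, \<open>n div p ^ e\<close> has the digits of
  \<open>K\<close>, and digits determine the number.\<close>

lemma div_power_of_base_digits_prefix:
  assumes "p \<ge> 2" "take (length (base_digits p K)) (base_digits p n) = base_digits p K"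
  obtains e where "n div p ^ e = K"
proof -
  have "rev (drop (length (digits_rev p n) - length (digits_rev p K)) (digits_rev p n)) =
      rev (digits_rev p K)"
    using assms(2) unfolding base_digits_def by (simp add: take_rev)
  then show ?thesis
    using that digits_rev_inject[OF assms(1)]
    by (metis drop_digits_rev[OF assms(1)] rev_is_rev_conv)
qed

section \<open>The inequality outside the tree\<close>

lemma H_pos:
  assumes "k \<le> n"
  shows "H n k > 0"
proof -
  have pos: "1 / (\<Prod>i\<in>S. of_nat i :: rat) > 0" if "S \<subseteq> {1..n}" for S
    using that by (auto intro!: divide_pos_pos prod_pos)
  have "{1..k} \<in> {S. S \<subseteq> {1..n} \<and> card S = k}" using assms by auto
  moreover have "finite {S. S \<subseteq> {1..n} \<and> card S = k}" by simp
  ultimately show ?thesis unfolding H_def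
    using pos by (intro sum_pos2[of _ "{1..k}"]) (auto intro: less_imp_le)
qed

text \<open>A valuation above \<open>- e * K\<close> would make
  \<open>p ^ (e * K) * H n (Suc K)\<close> divisible by \<open>p\<close>, and multiplying by
  \<open>fact K\<close> would put \<open>n\<close> in \<open>exceptional p K e\<close>.\<close>

lemma padic_val_H_less:
  fixes p K n e :: nat
  assumes "prime p" "K \<ge> 1" "n div p ^ e = K" "n > K" "n \<notin> exceptional p K e"
  shows "real_of_int (padic_val p (H n (Suc K))) < - real K * (log p n - log p K - 1)"
proof -
  have p: "p \<ge> 2" using assms(1) prime_ge_2_nat by blast
  have "padic_val p (H n (Suc K)) \<le> - int (e * K)"
  proof (rule ccontr)
    assume "\<not> ?thesis"
    then have "p_integral p (of_nat p ^ (e * K) * H n (Suc K) / of_nat p)"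
      using assms H_pos[of "Suc K" n] by (intro p_integral_of_padic_val) auto
    then have "p_integral p (of_nat (fact K) * (of_nat p ^ (e * K) * H n (Suc K) / of_nat p))"
      by (intro p_integral_mult p_integral_of_nat assms(1))
    then show False using assms(3,5) unfolding exceptional_def scaled_H_def by (simp add: mult.assoc)
  qed
  then have "real_of_int (padic_val p (H n (Suc K))) \<le> real_of_int (- int (e * K))"
    by (simp only: of_int_le_iff)
  \<comment> \<open>$n < (K + 1) p^e \le K p^{e+1}$, so the right-hand side exceeds $-eK$.\<close>
  also have "\<dots> < - real K * (log p n - log p K - 1)"
  proof -
    have "n < (K + 1) * p ^ e"
      using assms(3) p by (metis Suc_eq_plus1 div_less_iff_less_mult lessI zero_less_power pos2 less_le_trans)
    also have "\<dots> \<le> p * K * p ^ e"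
    proof -
      have "K + 1 \<le> 2 * K" using assms(2) by simp
      also have "\<dots> \<le> p * K" using p by simp
      finally show ?thesis by (rule mult_le_mono1)
    qed
    finally have "real n < real (p * K * p ^ e)" by (simp only: of_nat_less_iff)
    then have "log p n < log p (p * K * p ^ e)"
      using p assms(4) by (subst log_less_cancel_iff) auto
    also have "log p (p * K * p ^ e) = 1 + log p K + e"
      using p assms(2) by (simp add: log_mult log_nat_power)
    finally have "real K * (log p n - log p K - 1) < real K * e"
      using assms(2) by simp
    then show ?thesis by (simp add: mult.commute)
  qed
  finally show ?thesis .
qed

text \<open>From \<open>q \<ge> 3/2\<close> follows \<open>3 * q ^ E \<le> 2 * q ^ Suc E\<close>,
  which leaves room for the next term \<open>q ^ Suc E\<close>.\<close>

lemma geometric_sum_le: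
  fixes q :: real
  assumes "q \<ge> 3/2"
  shows "(\<Sum>e\<in>{1..E}. q ^ e) \<le> 3 * q ^ E"
proof (induction E)
  case (Suc E)
  have "3 * q ^ E \<le> 2 * q * q ^ E" using assms by (intro mult_right_mono) auto
  with Suc show ?case by simp
qed simp

theorem theorem2p2:
  fixes p k :: nat and x :: real
  assumes "prime p" and "k \<ge> 2" and "x \<ge> real ((k - 1) * p)"
  shows "real (card {n::nat. (k - 1) * p \<le> n \<and> real n \<le> x
            \<and> take (length (base_digits p (k - 1))) (base_digits p n) = base_digits p (k - 1)
            \<and> \<not> (real_of_int (padic_val p (H n k))
                   < - real (k - 1) * (log (real p) (real n) - log (real p) (real (k - 1)) - 1))})
         \<le> 3 * x powr 0.835"
proof -
  define K where "K = k - 1"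
  have K: "K \<ge> 1" "k = Suc K" "k - 1 = K" using assms(2) unfolding K_def by auto
  have p: "p \<ge> 2" using assms(1) prime_ge_2_nat by blast
  have "1 * 2 \<le> K * p" using K(1) p by (intro mult_le_mono) auto
  then have "real 2 \<le> real (K * p)" by (simp only: of_nat_le_iff)
  then have x: "x \<ge> 2" using assms(3) unfolding K by simp
  define q where "q = real p powr (5/6)"
  \<comment> \<open>The last level that can matter: the largest exponent with
    \<open>p ^ E \<le> x\<close>.\<close>
  define E where "E = nat \<lfloor>log p x\<rfloor>"
  define X where "X = {n::nat. K * p \<le> n \<and> real n \<le> x
            \<and> take (length (base_digits p K)) (base_digits p n) = base_digits p K
            \<and> \<not> (real_of_int (padic_val p (H n (Suc K)))
                   < - real K * (log (real p) (real n) - log (real p) (real K) - 1))}"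
  have "n \<in> (\<Union>e\<in>{1..E}. exceptional p K e)" if n: "n \<in> X" for n
  proof -
    obtain e where e: "n div p ^ e = K"
      using div_power_of_base_digits_prefix[OF p] n unfolding X_def by blast
    have "K * 1 < K * p" using K p by (intro mult_strict_left_mono) auto
    then have "n > K" using n unfolding X_def mult_1_right by (blast intro: less_le_trans)
    then have exc: "n \<in> exceptional p K e"
      using padic_val_H_less[OF assms(1) K(1) e] n unfolding X_def by blast
    have "e \<noteq> 0" using e \<open>n > K\<close> by (intro notI) simp
    moreover have "e \<le> E"
    proof -
      \<comment> \<open>Otherwise the quotient \<open>K\<close> would be 0.\<close>
      have "p ^ e \<le> n" using e K(1) by (cases "n < p ^ e") auto
      then have "real (p ^ e) \<le> real n" by (simp only: of_nat_le_iff)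
      moreover have "real n \<le> x" using n unfolding X_def by blast
      ultimately have "real p ^ e \<le> x" unfolding of_nat_power by linarith
      then have "real e \<le> log p x" using p x by (simp add: le_log_iff powr_realpow)
      then show ?thesis unfolding E_def by linarith
    qed
    ultimately show ?thesis using exc by auto
  qed
  then have "card X \<le> card (\<Union>e\<in>{1..E}. exceptional p K e)"
    using card_exceptional_le[OF assms(1)] by (intro card_mono) auto
  also have "\<dots> \<le> (\<Sum>e\<in>{1..E}. card (exceptional p K e))"
    by (intro card_UN_le) simp
  finally have "real (card X) \<le> (\<Sum>e\<in>{1..E}. real (card (exceptional p K e)))"
    by (simp only: of_nat_le_iff flip: of_nat_sum)
  also have "\<dots> \<le> (\<Sum>e\<in>{1..E}. q ^ e)"
    using card_exceptional_le[OF assms(1)] unfolding q_def by (intro sum_mono) auto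
  also have "\<dots> \<le> 3 * q ^ E"
  proof (rule geometric_sum_le)
    \<comment> \<open>The sixth power of the right side is 32, while that of 3/2 is below
      12.\<close>
    have "(3/2 :: real) ^ 6 \<le> (2 powr (5/6)) ^ 6" by (simp add: powr_power power_divide)
    then have "(3/2 :: real) \<le> 2 powr (5/6)"
      using power_mono_iff[of "3/2 :: real" "2 powr (5/6)" 6] by simp
    also have "\<dots> \<le> q" unfolding q_def using p by (intro powr_mono2) auto
    finally show "3/2 \<le> q" .
  qed
  also have "q ^ E = (real p ^ E) powr (5/6)"
  proof -
    have "(real p ^ E) powr (5/6) = (real p powr real E) powr (5/6)"
      using p by (simp add: powr_realpow)
    also have "\<dots> = q ^ E"
      unfolding q_def using p by (simp only: powr_powr powr_power mult.commute)
    finally show ?thesis by (rule sym)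
  qed
  also have "\<dots> \<le> x powr (5/6)"
  proof (intro powr_mono2)
    have "log p x \<ge> 0" using p x by simp
    then have "real E \<le> log p x" unfolding E_def by linarith
    then show "real p ^ E \<le> x" using p x by (simp add: le_log_iff powr_realpow)
  qed auto
  \<comment> \<open>The exponent 5/6 = 0.8333... lies just below 0.835.\<close>
  also have "\<dots> \<le> x powr 0.835" using x by (intro powr_mono) auto
  finally show ?thesis unfolding X_def K(3) K(2)[symmetric] by simp
qed

end
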